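(* Let $n\ge 2$ and $0<\epsilon<1$. For the inverse riffle shuffle on a deck of $n$ cards, the mixing time $t_{\mathrm{mix}}(\epsilon)$ for the location of the card labelled $1$ satisfies $t_{\mathrm{mix}}(\epsilon)\le \log_2(n-1)-\log_2(\epsilon)$.
   Context: One step of the inverse riffle shuffle on a deck of $n$ cards labelled $1,\dots,n$: assign to each card an independent uniformly random bit in $\{0,1\}$, then sort the deck by these bits, breaking ties by the previous order of the cards. For a statistic $f$ (a function of the deck order), the stationary distribution of $f$ is the distribution of $f$ on a uniformly random deck order. The mixing time $t_{\mathrm{mix}}(\epsilon)$ for $f$ is the number of steps needed so that, for every starting order, the distribution of $f$ is within $\epsilon$ of its stationary distribution in total variation distance; a bound $t_{\mathrm{mix}}(\epsilon)\le T$ with $T$ real means that this holds after $t$ steps for every nonnegative integer $t\ge T$. *)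

theory Defs
  imports "HOL-Probability.Probability" "HOL-Combinatorics.Multiset_Permutations"
begin

definition tv_dist :: "'a pmf \<Rightarrow> 'a pmf \<Rightarrow> real" where
  "tv_dist p q = (SUP A. \<bar>measure_pmf.prob p A - measure_pmf.prob q A\<bar>)"

(* Deck orders are lists, read from the top card to the bottom card. *)
definition deck_orders :: "nat \<Rightarrow> nat list set" where
  "deck_orders n = permutations_of_set {1..n}"

(* sort_key is a stable sort, so cards with equal bits keep their previous relative order. *)
definition inverse_riffle_step :: "'a list \<Rightarrow> 'a list pmf" where
  "inverse_riffle_step xs =
     map_pmf (\<lambda>b. sort_key b xs) (Pi_pmf (set xs) 0 (\<lambda>_. pmf_of_set {0, 1::nat}))"

definition inverse_riffle :: "nat \<Rightarrow> 'a list \<Rightarrow> 'a list pmf" where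
  "inverse_riffle t xs = ((\<lambda>p. bind_pmf p inverse_riffle_step) ^^ t) (return_pmf xs)"

(* Locations are counted from 0; the value is meaningful when the list is distinct and contains c. *)
definition location :: "'a \<Rightarrow> 'a list \<Rightarrow> nat" where
  "location c xs = (THE i. i < length xs \<and> xs ! i = c)"

definition stationary_distribution :: "nat \<Rightarrow> (nat list \<Rightarrow> 'b) \<Rightarrow> 'b pmf" where
  "stationary_distribution n f = map_pmf f (pmf_of_set (deck_orders n))"

(* The bound t_mix(eps) <= T for the statistic f and a real number T. It is a statement about all
   integers t >= T: the least integer t for which f is mixed may exceed T by a fractional part. *)
definition mixing_time_le :: "nat \<Rightarrow> (nat list \<Rightarrow> 'b) \<Rightarrow> real \<Rightarrow> real \<Rightarrow> bool" where
  "mixing_time_le n f eps T \<longleftrightarrow>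
     (\<forall>t::nat. real t \<ge> T \<longrightarrow> (\<forall>xs\<in>deck_orders n.
        tv_dist (map_pmf f (inverse_riffle t xs)) (stationary_distribution n f) \<le> eps))"

end

theory Submission
  imports Defs
begin

text \<open>
  Reading the bits that a card receives in \<open>t\<close> steps as a binary number, with the latest bit the
  most significant, gives every card an independent uniform label in \<open>{..<2 ^ t}\<close>. Since sorting is
  stable, \<open>t\<close> steps amount to a single stable sort by these labels (\<open>inverse_riffle_eq_sort_labels\<close>).

  Let two decks, one in the given order and one in uniformly random order, be sorted by the same
  labels. If no other card shares the label of card \<open>1\<close>, then in both decks the cards above card
  \<open>1\<close> are exactly those with a smaller label, so card \<open>1\<close> has the same location in both
  (\<open>location_sort_key\<close>). The second deck is still uniformly distributed
  (\<open>sort_iid_labels_uniform\<close>). Hence the total variation distance is at most the probability that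
  one of the \<open>n - 1\<close> other cards shares the label of card \<open>1\<close>. Given the labels of the others,
  at most \<open>n - 1\<close> of the \<open>2 ^ t\<close> values are to be avoided, so this probability is at most
  \<open>(n - 1) / 2 ^ t\<close>, which is at most \<open>eps\<close> for every \<open>t\<close> in question.
\<close>

section \<open>Stable sorting\<close>

lemma sort_key_cong:
  assumes "\<And>x. x \<in> set xs \<Longrightarrow> f x = g x"
  shows "sort_key f xs = sort_key g xs"
proof -
  have insort: "insort_key f a ys = insort_key g a ys"
    if "f a = g a" "\<And>x. x \<in> set ys \<Longrightarrow> f x = g x" for a ys
    using that by (induction ys) auto
  show ?thesis
    using assms by (induction xs) (auto intro: insort)
qed

lemma map_sort_key: "map f (sort_key (\<lambda>x. k (f x)) xs) = sort_key k (map f xs)"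
proof -
  have insort: "map f (insort_key (\<lambda>x. k (f x)) a ys) = insort_key k (f a) (map f ys)" for a ys
    by (induction ys) auto
  show ?thesis
    by (induction xs) (auto simp: insort)
qed

lemma sorted_lexicographic_key:
  fixes b l :: "'a \<Rightarrow> nat"
  assumes "sorted (map b zs)"
    and "\<And>k. sorted (map l (filter (\<lambda>x. b x = k) zs))"
    and "\<And>x. x \<in> set zs \<Longrightarrow> l x < M"
  shows "sorted (map (\<lambda>x. b x * M + l x) zs)"
  using assms
proof (induction zs)
  case (Cons z zs)
  have "sorted (map l (filter (\<lambda>x. b x = k) zs))" for k
    using Cons.prems(2)[of k] by (auto split: if_splits)
  then have "sorted (map (\<lambda>x. b x * M + l x) zs)"
    using Cons by auto
  moreover have "b z * M + l z \<le> b x * M + l x" if x: "x \<in> set zs" for x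
  proof (cases "b z = b x")
    case True
    then show ?thesis
      using Cons.prems(2)[of "b z"] x by auto
  next
    case False
    then have "Suc (b z) \<le> b x"
      using Cons.prems(1) x by (auto simp: Suc_le_eq le_less)
    then have "Suc (b z) * M \<le> b x * M"
      by (rule mult_le_mono1)
    then show ?thesis
      using Cons.prems(3)[of z] by simp
  qed
  ultimately show ?case
    by auto
qed simp

text \<open>
  Stability makes the earlier key the tie-breaker of the later one, as in radix sort; for keys below
  \<open>M\<close> the lexicographic order of the key pairs is the numerical order of \<open>b x * M + l x\<close>.
\<close>

lemma sort_key_sort_key:
  fixes b l :: "'a \<Rightarrow> nat"
  assumes less: "\<And>x. x \<in> set xs \<Longrightarrow> l x < M"
  shows "sort_key b (sort_key l xs) = sort_key (\<lambda>x. b x * M + l x) xs"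
proof (rule sym, rule properties_for_sort_key)
  let ?zs = "sort_key b (sort_key l xs)"
  show "mset ?zs = mset xs"
    by simp
  show "sorted (map (\<lambda>x. b x * M + l x) ?zs)"
  proof (rule sorted_lexicographic_key)
    show "sorted (map l (filter (\<lambda>x. b x = k) ?zs))" for k
      unfolding sort_key_stable by (rule sorted_filter) simp
  qed (use less in auto)
  fix k
  assume "k \<in> set ?zs"
  then have k: "l k < M"
    using less by simp
  have digits: "b k * M + l k = b x * M + l x \<longleftrightarrow> l x = l k \<and> b x = b k" if "x \<in> set xs" for x
  proof
    assume eq: "b k * M + l k = b x * M + l x"
    from arg_cong[OF eq, of "\<lambda>y. y mod M"] arg_cong[OF eq, of "\<lambda>y. y div M"]
    show "l x = l k \<and> b x = b k"
      using k less[OF that] by simp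
  qed simp
  have "filter (\<lambda>x. b k * M + l k = b x * M + l x) ?zs
      = filter (\<lambda>x. l x = l k) (filter (\<lambda>x. b x = b k) ?zs)"
    unfolding filter_filter by (rule filter_cong) (use digits in auto)
  also have "\<dots> = filter (\<lambda>x. b x = b k) (filter (\<lambda>x. l x = l k) (sort_key l xs))"
    unfolding sort_key_stable[of b] filter_filter by (rule filter_cong) auto
  also have "\<dots> = filter (\<lambda>x. b k * M + l k = b x * M + l x) xs"
    unfolding sort_key_stable filter_filter by (rule filter_cong) (use digits in auto)
  finally show "filter (\<lambda>x. b k * M + l k = b x * M + l x) ?zs
      = filter (\<lambda>x. b k * M + l k = b x * M + l x) xs" .
qed

lemma location_append:
  assumes "distinct (as @ c # bs)"
  shows "location c (as @ c # bs) = length as"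
  unfolding location_def
proof (rule the_equality)
  fix i
  assume "i < length (as @ c # bs) \<and> (as @ c # bs) ! i = c"
  moreover have "length as < length (as @ c # bs)" "(as @ c # bs) ! length as = c"
    by simp_all
  ultimately show "i = length as"
    using nth_eq_iff_index_eq[OF assms] by metis
qed simp

text \<open>
  For given labels, the value depends on the deck only through its set of cards. This is why decks in
  different orders, sorted by the same labels, agree on the location of a card with a unique label.
\<close>

lemma location_sort_key:
  fixes l :: "'a \<Rightarrow> nat"
  assumes "distinct xs" "c \<in> set xs"
    and unique: "\<And>x. x \<in> set xs \<Longrightarrow> x \<noteq> c \<Longrightarrow> l x \<noteq> l c"
  shows "location c (sort_key l xs) = card {x \<in> set xs. l x < l c}"
proof -
  have "c \<in> set (sort_key l xs)"
    using assms by simp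
  then obtain as bs where split: "sort_key l xs = as @ c # bs"
    by (meson split_list)
  have dist: "distinct (as @ c # bs)"
    using assms(1) by (simp flip: split)
  have set: "set xs = set as \<union> {c} \<union> set bs"
    using arg_cong[OF split, of set] by auto
  have sorted: "sorted (map l (as @ c # bs))"
    unfolding split[symmetric] by simp
  have "l x < l c" if "x \<in> set as" for x
    using sorted dist that unique[of x] set by (force simp: sorted_append le_less)
  moreover have "l c \<le> l x" if "x \<in> set bs" for x
    using sorted that by (auto simp: sorted_append)
  ultimately have "{x \<in> set xs. l x < l c} = set as"
    unfolding set by (auto simp: not_less[symmetric])
  then show ?thesis
    using dist by (simp add: split location_append distinct_card)
qed

section \<open>Repeated shuffles as one sort by uniform labels\<close>

lemma pmf_of_set_lessThan_double:
  assumes "0 < M"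
  shows "pmf_of_set {..<2 * M}
    = do {u \<leftarrow> pmf_of_set {..<M}; v \<leftarrow> pmf_of_set {0, 1::nat}; return_pmf (v * M + u)}"
proof -
  let ?f = "\<lambda>(u, v). v * M + u :: nat"
  have "bij_betw ?f ({..<M} \<times> {0, 1}) {..<2 * M}"
  proof (rule bij_betwI[where g = "\<lambda>y. (y mod M, y div M)"])
    show "(\<lambda>y. (y mod M, y div M)) \<in> {..<2 * M} \<rightarrow> {..<M} \<times> {0, 1}"
      using assms by (auto simp: less_mult_imp_div_less dest!: less_mult_imp_div_less)
  qed (use assms in auto)
  then have "pmf_of_set {..<2 * M} = map_pmf ?f (pmf_of_set ({..<M} \<times> {0, 1}))"
    using assms by (intro map_pmf_of_set_bij_betw[symmetric]) auto
  also have "pmf_of_set ({..<M} \<times> {0, 1::nat}) = pair_pmf (pmf_of_set {..<M}) (pmf_of_set {0, 1})"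
    using assms by (intro pmf_eqI) (auto simp: pmf_pair indicator_def lessThan_empty_iff)
  finally show ?thesis
    by (simp add: pair_pmf_def map_pmf_def bind_assoc_pmf bind_return_pmf)
qed

lemma inverse_riffle_eq_sort_labels:
  "inverse_riffle t xs
    = map_pmf (\<lambda>l. sort_key l xs) (Pi_pmf (set xs) 0 (\<lambda>_. pmf_of_set {..<2 ^ t :: nat}))"
proof (induction t)
  case 0
  have "pmf_of_set {..<1::nat} = return_pmf 0"
    by (simp add: lessThan_Suc pmf_of_set_singleton)
  then show ?case
    by (simp add: inverse_riffle_def sort_key_const del: One_nat_def)
next
  case (Suc t)
  let ?M = "2 ^ t :: nat"
  let ?L = "Pi_pmf (set xs) 0 (\<lambda>_. pmf_of_set {..<?M})"
  let ?B = "Pi_pmf (set xs) 0 (\<lambda>_. pmf_of_set {0, 1::nat})"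
  have labels: "Pi_pmf (set xs) 0 (\<lambda>_. pmf_of_set {..<2 ^ Suc t :: nat})
      = do {l \<leftarrow> ?L; b \<leftarrow> ?B; return_pmf (\<lambda>x. if x \<in> set xs then b x * ?M + l x else 0)}"
    by (simp add: pmf_of_set_lessThan_double Pi_pmf_bind[where d' = 0] del: insert_iff)
  have less: "l x < ?M" if "l \<in> set_pmf ?L" "x \<in> set xs" for l x
  proof -
    have "{..<?M} \<noteq> {}"
      by (auto simp: lessThan_empty_iff)
    then show ?thesis
      using that by (auto simp: set_Pi_pmf PiE_dflt_def)
  qed
  have "inverse_riffle (Suc t) xs = bind_pmf (inverse_riffle t xs) inverse_riffle_step"
    by (simp add: inverse_riffle_def)
  also have "\<dots> = do {l \<leftarrow> ?L; b \<leftarrow> ?B; return_pmf (sort_key b (sort_key l xs))}"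
    by (simp add: Suc.IH inverse_riffle_step_def map_pmf_def bind_assoc_pmf bind_return_pmf)
  also have "\<dots> = do {l \<leftarrow> ?L; b \<leftarrow> ?B;
      return_pmf (sort_key (\<lambda>x. if x \<in> set xs then b x * ?M + l x else 0) xs)}"
  proof (intro bind_pmf_cong refl arg_cong[of _ _ return_pmf])
    fix l b
    assume "l \<in> set_pmf ?L"
    then have "sort_key b (sort_key l xs) = sort_key (\<lambda>x. b x * ?M + l x) xs"
      by (intro sort_key_sort_key less)
    then show "sort_key b (sort_key l xs)
        = sort_key (\<lambda>x. if x \<in> set xs then b x * ?M + l x else 0) xs"
      by (simp cong: sort_key_cong)
  qed
  also have "\<dots> = map_pmf (\<lambda>l. sort_key l xs) (Pi_pmf (set xs) 0 (\<lambda>_. pmf_of_set {..<2 ^ Suc t :: nat}))"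
    unfolding labels by (simp add: map_pmf_def bind_assoc_pmf bind_return_pmf)
  finally show ?case .
qed

section \<open>Invariance of the uniform distribution\<close>

text \<open>
  Labels that are iid over cards are iid over positions. Sorting by position labels is a fixed
  rearrangement of positions, which permutes the deck orders.
\<close>

lemma sort_iid_labels_by_position:
  fixes p :: "'k::linorder pmf"
  assumes "distinct xs"
  shows "map_pmf (\<lambda>l. sort_key l xs) (Pi_pmf (set xs) d (\<lambda>_. p))
    = map_pmf (\<lambda>g. map ((!) xs) (sort_key g [0..<length xs])) (Pi_pmf {..<length xs} d (\<lambda>_. p))"
proof -
  \<comment> \<open>Cards outside the deck go to a value that is no position, as reindexing the labels requires
    their default value there.\<close>
  define pos where
    "pos c = (if c \<in> set xs then the_inv_into {..<length xs} ((!) xs) c else length xs)" for c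
  have bij: "bij_betw ((!) xs) {..<length xs} (set xs)"
    using assms by (simp add: bij_betw_nth)
  have pos_nth: "pos (xs ! i) = i" if "i < length xs" for i
    using that bij by (simp add: pos_def the_inv_into_f_f bij_betw_def)
  have "bij_betw pos (set xs) {..<length xs} \<longleftrightarrow>
      bij_betw (the_inv_into {..<length xs} ((!) xs)) (set xs) {..<length xs}"
    by (rule bij_betw_cong) (simp add: pos_def)
  then have "bij_betw pos (set xs) {..<length xs}"
    using bij_betw_the_inv_into[OF bij] by simp
  then have "Pi_pmf (set xs) d (\<lambda>_. p) = map_pmf (\<lambda>g. g \<circ> pos) (Pi_pmf {..<length xs} d (\<lambda>_. p))"
    by (intro Pi_pmf_bij_betw) (auto simp: pos_def)
  moreover have "sort_key (g \<circ> pos) xs = map ((!) xs) (sort_key g [0..<length xs])"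
    for g :: "nat \<Rightarrow> 'k"
  proof -
    have "sort_key (g \<circ> pos) xs = sort_key (g \<circ> pos) (map ((!) xs) [0..<length xs])"
      by (simp add: map_nth)
    also have "\<dots> = map ((!) xs) (sort_key (\<lambda>i. (g \<circ> pos) (xs ! i)) [0..<length xs])"
      by (rule map_sort_key[symmetric])
    also have "sort_key (\<lambda>i. (g \<circ> pos) (xs ! i)) [0..<length xs] = sort_key g [0..<length xs]"
      by (rule sort_key_cong) (simp add: pos_nth)
    finally show ?thesis .
  qed
  ultimately show ?thesis
    by (simp add: pmf.map_comp comp_def[of "\<lambda>l. sort_key l xs"])
qed

lemma rearrange_uniform:
  assumes "finite A" and is_perm: "distinct is" "set is = {..<card A}"
  shows "map_pmf (\<lambda>xs. map ((!) xs) is) (pmf_of_set (permutations_of_set A))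
    = pmf_of_set (permutations_of_set A)"
proof (rule map_pmf_of_set_bij_betw)
  let ?P = "permutations_of_set A"
  have len: "length xs = card A" if "xs \<in> ?P" for xs
    using that by (simp add: length_finite_permutations_of_set)
  have "inj_on (\<lambda>xs. map ((!) xs) is) ?P"
  proof (rule inj_onI)
    fix xs ys
    assume "xs \<in> ?P" "ys \<in> ?P" "map ((!) xs) is = map ((!) ys) is"
    then show "xs = ys"
      using is_perm len by (intro nth_equalityI) auto
  qed
  moreover have "(\<lambda>xs. map ((!) xs) is) ` ?P \<subseteq> ?P"
  proof safe
    fix xs
    assume xs: "xs \<in> ?P"
    then have "bij_betw ((!) xs) {..<card A} A"
      using len[OF xs] permutations_of_setD[OF xs] by (metis bij_betw_nth)
    then show "map ((!) xs) is \<in> ?P"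
      using is_perm by (intro permutations_of_setI) (auto simp: distinct_map bij_betw_def)
  qed
  ultimately show "bij_betw (\<lambda>xs. map ((!) xs) is) ?P ?P"
    by (simp add: bij_betw_def endo_inj_surj)
qed (use assms in auto)

lemma sort_iid_labels_uniform:
  assumes "finite A"
  shows "do {xs \<leftarrow> pmf_of_set (permutations_of_set A);
      map_pmf (\<lambda>l. sort_key l xs) (Pi_pmf A d (\<lambda>_. p))} = pmf_of_set (permutations_of_set A)"
proof -
  let ?U = "pmf_of_set (permutations_of_set A)"
  let ?G = "Pi_pmf {..<card A} d (\<lambda>_. p)"
  have "do {xs \<leftarrow> ?U; map_pmf (\<lambda>l. sort_key l xs) (Pi_pmf A d (\<lambda>_. p))}
      = do {xs \<leftarrow> ?U; g \<leftarrow> ?G; return_pmf (map ((!) xs) (sort_key g [0..<card A]))}"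
  proof (rule bind_pmf_cong[OF refl])
    fix xs
    assume "xs \<in> set_pmf ?U"
    then have "xs \<in> permutations_of_set A"
      using assms by simp
    then have "set xs = A" "distinct xs" "length xs = card A"
      by (auto dest: permutations_of_setD simp: length_finite_permutations_of_set)
    then show "map_pmf (\<lambda>l. sort_key l xs) (Pi_pmf A d (\<lambda>_. p))
        = do {g \<leftarrow> ?G; return_pmf (map ((!) xs) (sort_key g [0..<card A]))}"
      using sort_iid_labels_by_position[of xs d p] by (simp add: map_pmf_def)
  qed
  also have "\<dots> = do {g \<leftarrow> ?G; map_pmf (\<lambda>xs. map ((!) xs) (sort_key g [0..<card A])) ?U}"
    by (subst bind_commute_pmf) (simp add: map_pmf_def)
  also have "\<dots> = do {g \<leftarrow> ?G; ?U}"
    using assms by (intro bind_pmf_cong refl rearrange_uniform) auto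
  finally show ?thesis
    by simp
qed

section \<open>The coupling\<close>

lemma tv_dist_coupling:
  assumes "\<And>x. x \<in> set_pmf R \<Longrightarrow> f x \<noteq> g x \<Longrightarrow> x \<in> D"
  shows "tv_dist (map_pmf f R) (map_pmf g R) \<le> measure_pmf.prob R D"
  unfolding tv_dist_def
proof (rule cSUP_least)
  fix A
  have le: "measure_pmf.prob R (h -` A) \<le> measure_pmf.prob R (k -` A) + measure_pmf.prob R D"
    if "\<And>x. x \<in> set_pmf R \<Longrightarrow> h x \<noteq> k x \<Longrightarrow> x \<in> D" for h k :: "_ \<Rightarrow> 'b"
  proof -
    have "measure_pmf.prob R (h -` A) \<le> measure_pmf.prob R (k -` A \<union> D)"
    proof (rule measure_pmf.finite_measure_mono_AE)
      show "AE x in measure_pmf R. x \<in> h -` A \<longrightarrow> x \<in> k -` A \<union> D"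
        unfolding AE_measure_pmf_iff using that by (metis UnCI vimage_eq)
    qed simp
    also have "\<dots> \<le> measure_pmf.prob R (k -` A) + measure_pmf.prob R D"
      by (rule measure_Un_le) auto
    finally show ?thesis .
  qed
  show "\<bar>measure_pmf.prob (map_pmf f R) A - measure_pmf.prob (map_pmf g R) A\<bar>
      \<le> measure_pmf.prob R D"
    using le[of f g] le[of g f] assms by fastforce
qed simp

text \<open>
  By independence the label of \<open>c\<close> may be drawn last. The labels of the other cards are then fixed,
  and they take at most \<open>card A - 1\<close> of the \<open>card S\<close> equally likely values.
\<close>

lemma prob_label_shared_le:
  assumes "finite A" "c \<in> A" "finite S" "S \<noteq> {}"
  shows "measure_pmf.prob (Pi_pmf A d (\<lambda>_. pmf_of_set S)) {l. \<exists>x\<in>A - {c}. l x = l c}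
    \<le> real (card A - 1) / real (card S)"
proof -
  let ?E = "{l. \<exists>x\<in>A - {c}. l x = l c}"
  let ?p = "pmf_of_set S"
  let ?Q = "Pi_pmf (A - {c}) d (\<lambda>_. ?p)"
  let ?r = "real (card A - 1) / real (card S)"
  have "Pi_pmf A d (\<lambda>_. ?p) = Pi_pmf (insert c (A - {c})) d (\<lambda>_. ?p)"
    using assms by (simp add: insert_absorb)
  also have "\<dots> = do {f \<leftarrow> ?Q; map_pmf (\<lambda>y. f(c := y)) ?p}"
    using assms by (subst Pi_pmf_insert') (simp_all add: map_pmf_def bind_commute_pmf[of ?p])
  finally have split: "Pi_pmf A d (\<lambda>_. ?p) = do {f \<leftarrow> ?Q; map_pmf (\<lambda>y. f(c := y)) ?p}" .
  have given_others: "emeasure (map_pmf (\<lambda>y. f(c := y)) ?p) ?E \<le> ennreal ?r" for f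
  proof -
    have "card (S \<inter> f ` (A - {c})) \<le> card (f ` (A - {c}))"
      using assms by (intro card_mono) auto
    also have "\<dots> \<le> card A - 1"
      using card_image_le[of "A - {c}" f] assms by simp
    finally have "measure_pmf.prob ?p (f ` (A - {c})) \<le> ?r"
      using assms by (simp add: measure_pmf_of_set divide_right_mono)
    moreover have "(\<lambda>y. f(c := y)) -` ?E = f ` (A - {c})"
      by (auto simp: image_iff)
    ultimately show ?thesis
      by (simp add: measure_pmf.emeasure_eq_measure ennreal_leI)
  qed
  have "ennreal (measure_pmf.prob (Pi_pmf A d (\<lambda>_. ?p)) ?E)
      = (\<integral>\<^sup>+f. emeasure (map_pmf (\<lambda>y. f(c := y)) ?p) ?E \<partial>?Q)"
    unfolding measure_pmf.emeasure_eq_measure[symmetric] split by simp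
  also have "\<dots> \<le> (\<integral>\<^sup>+f. ennreal ?r \<partial>?Q)"
    by (intro nn_integral_mono given_others)
  also have "\<dots> = ennreal ?r"
    by simp
  finally show ?thesis
    by simp
qed

lemma tv_dist_location_le:
  assumes xs: "xs \<in> deck_orders n" and c: "c \<in> {1..n}"
  shows "tv_dist (map_pmf (location c) (inverse_riffle t xs))
      (stationary_distribution n (location c)) \<le> real (n - 1) / 2 ^ t"
proof -
  let ?U = "pmf_of_set (deck_orders n)"
  let ?L = "Pi_pmf {1..n} 0 (\<lambda>_. pmf_of_set {..<2 ^ t}) :: (nat \<Rightarrow> nat) pmf"
  let ?E = "{l. \<exists>x\<in>{1..n} - {c}. l x = l c} :: (nat \<Rightarrow> nat) set"
  \<comment> \<open>One labelling and an independent uniform deck: both decks are sorted by the same labels.\<close>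
  let ?R = "pair_pmf ?L ?U"
  let ?given = "\<lambda>(l, _). location c (sort_key l xs)"
  let ?uniform = "\<lambda>(l, ys). location c (sort_key l ys)"
  have deck: "distinct ys" "set ys = {1..n}" if "ys \<in> deck_orders n" for ys
    using that by (auto simp: deck_orders_def dest: permutations_of_setD)
  have given: "map_pmf (location c) (inverse_riffle t xs) = map_pmf ?given ?R"
  proof -
    have "map_pmf ?given ?R = map_pmf (\<lambda>l. location c (sort_key l xs)) (map_pmf fst ?R)"
      by (simp only: pmf.map_comp o_def case_prod_unfold)
    also have "\<dots> = map_pmf (location c) (inverse_riffle t xs)"
      unfolding inverse_riffle_eq_sort_labels deck(2)[OF xs]
      by (simp add: map_fst_pair_pmf pmf.map_comp o_def)
    finally show ?thesis ..
  qed
  have uniform: "stationary_distribution n (location c) = map_pmf ?uniform ?R"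
  proof -
    have "map_pmf ?uniform ?R
        = map_pmf (location c) (do {ys \<leftarrow> ?U; map_pmf (\<lambda>l. sort_key l ys) ?L})"
      unfolding pair_pmf_def map_pmf_def
      by (simp add: bind_assoc_pmf bind_return_pmf) (rule bind_commute_pmf)
    also have "\<dots> = stationary_distribution n (location c)"
      unfolding deck_orders_def stationary_distribution_def
      by (simp only: sort_iid_labels_uniform[OF finite_atLeastAtMost])
    finally show ?thesis ..
  qed
  have "tv_dist (map_pmf ?given ?R) (map_pmf ?uniform ?R) \<le> measure_pmf.prob ?R (fst -` ?E)"
  proof (rule tv_dist_coupling)
    fix z
    assume z: "z \<in> set_pmf ?R" and "?given z \<noteq> ?uniform z"
    obtain l ys where l_ys: "z = (l, ys)"
      by (cases z)
    with z have "ys \<in> deck_orders n"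
      by (simp add: deck_orders_def)
    moreover have "location c (sort_key l zs) = card {x \<in> {1..n}. l x < l c}"
      if "l \<notin> ?E" "zs \<in> deck_orders n" for zs
      using location_sort_key[of zs c l] that(1) c deck[OF that(2)] by auto
    ultimately show "z \<in> fst -` ?E"
      using xs l_ys \<open>?given z \<noteq> ?uniform z\<close>
      by (metis (no_types, lifting) case_prod_conv fst_conv vimage_eq)
  qed
  also have "\<dots> = measure_pmf.prob ?L ?E"
    by (simp only: measure_map_pmf[symmetric] map_fst_pair_pmf)
  also have "\<dots> \<le> real (n - 1) / 2 ^ t"
    using prob_label_shared_le[of "{1..n}" c "{..<2 ^ t :: nat}" 0] c by (simp add: lessThan_empty_iff)
  finally show ?thesis
    unfolding given uniform .
qed

theorem proposition30:
  fixes n :: nat and eps :: real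
  assumes "n \<ge> 2" and "0 < eps" and "eps < 1"
  shows "mixing_time_le n (location 1) eps (log 2 (real n - 1) - log 2 eps)"
  unfolding mixing_time_le_def
proof (intro allI impI ballI)
  fix t :: nat and xs
  assume t: "log 2 (real n - 1) - log 2 eps \<le> real t" and xs: "xs \<in> deck_orders n"
  have "log 2 ((real n - 1) / eps) \<le> real t"
    using t assms by (simp add: log_divide)
  then have "(real n - 1) / eps \<le> 2 ^ t"
    using assms by (simp add: log_le_iff powr_realpow)
  then have "real (n - 1) / 2 ^ t \<le> eps"
    using assms by (simp add: of_nat_diff field_simps)
  moreover have "1 \<in> {1..n}"
    using assms by simp
  ultimately show "tv_dist (map_pmf (location 1) (inverse_riffle t xs))
      (stationary_distribution n (location 1)) \<le> eps"
    using tv_dist_location_le[OF xs, of 1 t] by linarith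
qed

end
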